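(* Let $n\ge 1$. The diamond Italian square $\mathcal D_n$ of order $n$ possesses a transversal if and only if $n\equiv\pm1 \pmod 6$.
   Context: An alternating sign matrix (ASM) is a matrix with entries in $\{0,1,-1\}$ such that in each row and each column the non-zero entries alternate in sign, beginning and ending with $+1$. An alternating sign hypermatrix (ASHM) of order $n$ is an $n\times n\times n$ array $(a_{ijk})$ with entries in $\{0,1,-1\}$ such that the non-zero entries in each row, column and vertical line (i.e. each line obtained by fixing two of the three indices) alternate in sign, beginning and ending with $+1$. An Italian square $L$ of order $n$ is an $n\times n$ array whose cells contain signed formal sums of subsets of $\{1,\dots,n\}$ corresponding to an ASHM $(a_{ijk})$: the cell $(i,j)$ is $\sum_k a_{ijk}\,k$ as a formal sum. Its planes are the ASMs $L_k=(a_{ijk})_{i,j}$, $k=1,\dots,n$, and one writes $L=(L_1,\dots,L_n)$. The diamond Italian square $\mathcal D_n$ is the one corresponding to the ASHM with entries, for $i,j,k\in\{1,\dots,n\}$, $$(\mathcal D_n)_{ijk}=\begin{cases}(-1)^{i+j+k+1}&\text{if }|i+j-n-1|\le n-k\text{ and }|i-j|\le k-1,\\0&\text{otherwise.}\end{cases}$$ A transversal of an Italian square $L$ of order $n$ is an $n\times n$ ASM $A$ (not necessarily a permutation matrix) with $\langle A,L_k\rangle=1$ for every plane $L_k$ of $L$, where $\langle A,B\rangle=\sum_{i,j}A_{ij}B_{ij}$. *)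

theory Defs
  imports Main "HOL-Library.Poly_Mapping" "HOL-Number_Theory.Cong"
begin

text \<open>
  An array of order \<open>n\<close> is a function on naturals of which only the values at indices in
  \<open>{1..n}\<close> matter.
\<close>

definition alternating_line :: "nat \<Rightarrow> (nat \<Rightarrow> int) \<Rightarrow> bool" where
  "alternating_line n f \<longleftrightarrow>
     (\<forall>i\<in>{1..n}. f i \<in> {0, 1, -1}) \<and>
     (let xs = filter (\<lambda>x. x \<noteq> 0) (map f [1..<Suc n])
      in xs \<noteq> [] \<and> hd xs = 1 \<and> last xs = 1 \<and> successively (\<lambda>x y. y = - x) xs)"

definition asm :: "nat \<Rightarrow> (nat \<Rightarrow> nat \<Rightarrow> int) \<Rightarrow> bool" where
  "asm n A \<longleftrightarrow>
     (\<forall>i\<in>{1..n}. alternating_line n (\<lambda>j. A i j)) \<and>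
     (\<forall>j\<in>{1..n}. alternating_line n (\<lambda>i. A i j))"

definition ashm :: "nat \<Rightarrow> (nat \<Rightarrow> nat \<Rightarrow> nat \<Rightarrow> int) \<Rightarrow> bool" where
  "ashm n a \<longleftrightarrow>
     (\<forall>j\<in>{1..n}. \<forall>k\<in>{1..n}. alternating_line n (\<lambda>i. a i j k)) \<and>
     (\<forall>i\<in>{1..n}. \<forall>k\<in>{1..n}. alternating_line n (\<lambda>j. a i j k)) \<and>
     (\<forall>i\<in>{1..n}. \<forall>j\<in>{1..n}. alternating_line n (\<lambda>k. a i j k))"

text \<open>
  The cells of a square are formal integer combinations of symbols, i.e. finitely supported
  functions from symbols to coefficients.
\<close>

type_synonym square = "nat \<Rightarrow> nat \<Rightarrow> (nat \<Rightarrow>\<^sub>0 int)"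

definition square_of :: "nat \<Rightarrow> (nat \<Rightarrow> nat \<Rightarrow> nat \<Rightarrow> int) \<Rightarrow> square" where
  "square_of n a = (\<lambda>i j. \<Sum>k=1..n. Poly_Mapping.single k (a i j k))"

definition italian_square :: "nat \<Rightarrow> square \<Rightarrow> bool" where
  "italian_square n L \<longleftrightarrow>
     (\<exists>a. ashm n a \<and> (\<forall>i\<in>{1..n}. \<forall>j\<in>{1..n}. L i j = square_of n a i j))"

definition plane :: "square \<Rightarrow> nat \<Rightarrow> nat \<Rightarrow> nat \<Rightarrow> int" where
  "plane L k = (\<lambda>i j. Poly_Mapping.lookup (L i j) k)"

definition matrix_inner :: "nat \<Rightarrow> (nat \<Rightarrow> nat \<Rightarrow> int) \<Rightarrow> (nat \<Rightarrow> nat \<Rightarrow> int) \<Rightarrow> int" where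
  "matrix_inner n A B = (\<Sum>i=1..n. \<Sum>j=1..n. A i j * B i j)"

definition transversal :: "nat \<Rightarrow> square \<Rightarrow> (nat \<Rightarrow> nat \<Rightarrow> int) \<Rightarrow> bool" where
  "transversal n L A \<longleftrightarrow> asm n A \<and> (\<forall>k\<in>{1..n}. matrix_inner n A (plane L k) = 1)"

definition diamond_ashm :: "nat \<Rightarrow> nat \<Rightarrow> nat \<Rightarrow> nat \<Rightarrow> int" where
  "diamond_ashm n i j k =
     (if \<bar>int i + int j - int n - 1\<bar> \<le> int n - int k \<and> \<bar>int i - int j\<bar> \<le> int k - 1
      then (-1) ^ (i + j + k + 1) else 0)"

definition diamond :: "nat \<Rightarrow> square" where
  "diamond n = square_of n (diamond_ashm n)"

lemma plane_square_of:
  assumes "k \<in> {1..n}"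
  shows "plane (square_of n a) k i j = a i j k"
  using assms by (simp add: plane_def square_of_def lookup_sum lookup_single when_def)

lemma filter_upt_interval:
  assumes "1 \<le> a" "a \<le> b" "b \<le> n"
  shows "filter (\<lambda>i. a \<le> i \<and> i \<le> b) [1..<Suc n] = [a..<Suc b]"
  by (rule sorted_distinct_set_unique) (use assms in \<open>auto simp: sorted_wrt_filter simp del: upt_Suc\<close>)

lemma alternating_lineI:
  assumes ab: "1 \<le> a" "a \<le> b" "b \<le> n" and ev: "even (a + c)" "even (b + c)"
    and f: "\<And>i. i \<in> {1..n} \<Longrightarrow> f i = (if a \<le> i \<and> i \<le> b then (-1) ^ (i + c) else 0)"
  shows "alternating_line n f"
proof -
  have sgn: "(-1::int) ^ m \<in> {1, -1}" for m by (cases "even m") auto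
  have "filter (\<lambda>x. x \<noteq> 0) (map f [1..<Suc n])
      = map f (filter (\<lambda>i. a \<le> i \<and> i \<le> b) [1..<Suc n])"
    unfolding filter_map by (rule arg_cong[where f = "map f"], rule filter_cong) (auto simp: f split: if_splits simp del: upt_Suc)
  also have "\<dots> = map f [a..<Suc b]" by (simp only: filter_upt_interval[OF ab])
  also have "\<dots> = map (\<lambda>i. (-1) ^ (i + c)) [a..<Suc b]"
    using ab by (intro map_cong) (auto simp: f)
  finally have xs: "filter (\<lambda>x. x \<noteq> 0) (map f [1..<Suc n]) = map (\<lambda>i. (-1) ^ (i + c)) [a..<Suc b]" .
  have "successively (\<lambda>x y. y = - x) (map (\<lambda>i. (-1::int) ^ (i + c)) [a..<Suc b])"
    unfolding successively_conv_nth by (auto simp del: upt_Suc)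
  moreover have "hd (map (\<lambda>i. (-1::int) ^ (i + c)) [a..<Suc b]) = 1"
    using ab ev by (simp add: hd_map del: upt_Suc)
  moreover have "last (map (\<lambda>i. (-1::int) ^ (i + c)) [a..<Suc b]) = 1"
    using ab ev by simp
  ultimately show ?thesis
    unfolding alternating_line_def Let_def xs using ab sgn by (auto simp: f simp del: upt_Suc)
qed

lemma ashm_diamond: "ashm n (diamond_ashm n)"
proof -
  have line: "alternating_line n (\<lambda>i. diamond_ashm n i j k)"
    if "j \<in> {1..n}" "k \<in> {1..n}" for j k
  proof (rule alternating_lineI[where a = "nat (max (int j - int k + 1) (int k + 1 - int j))"
        and b = "nat (min (int j + int k - 1) (2 * int n + 1 - int k - int j))"
        and c = "j + k + 1"])
    show "even (nat (max (int j - int k + 1) (int k + 1 - int j)) + (j + k + 1))"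
      using that by (auto simp: even_nat_iff max_def nat_add_distrib)
    show "even (nat (min (int j + int k - 1) (2 * int n + 1 - int k - int j)) + (j + k + 1))"
      using that by (auto simp: even_nat_iff min_def nat_add_distrib)
  qed (use that in \<open>auto simp: diamond_ashm_def add_ac\<close>)
  moreover have "diamond_ashm n i j k = diamond_ashm n j i k" for i j k
    by (simp add: diamond_ashm_def add_ac abs_minus_commute)
  then have "(\<lambda>j. diamond_ashm n i j k) = (\<lambda>j. diamond_ashm n j i k)" for i k by blast
  moreover have "alternating_line n (\<lambda>k. diamond_ashm n i j k)"
    if "i \<in> {1..n}" "j \<in> {1..n}" for i j
  proof (rule alternating_lineI[where a = "nat (\<bar>int i - int j\<bar> + 1)"
        and b = "nat (int n - \<bar>int i + int j - int n - 1\<bar>)"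
        and c = "i + j + 1"])
    show "even (nat (\<bar>int i - int j\<bar> + 1) + (i + j + 1))"
      using that by (auto simp: even_nat_iff abs_if nat_add_distrib)
    show "even (nat (int n - \<bar>int i + int j - int n - 1\<bar>) + (i + j + 1))"
      using that by (auto simp: even_nat_iff abs_if nat_add_distrib)
  qed (use that in \<open>auto simp: diamond_ashm_def add_ac\<close>)
  ultimately show ?thesis by (simp add: ashm_def)
qed

lemma italian_square_diamond: "italian_square n (diamond n)"
  unfolding italian_square_def diamond_def using ashm_diamond by blast

end

theory Submission
  imports Defs
begin

text \<open>
  Fix a cell \<open>(i,j)\<close>. Along its vertical line the diamond array alternates in sign from
  \<open>k = \<bar>i - j\<bar> + 1\<close> up to \<open>k = n - \<bar>i + j - n - 1\<bar>\<close>, so the sum of two consecutive entries, at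
  \<open>k\<close> and \<open>k + 1\<close>, vanishes unless \<open>k\<close> is \<open>\<bar>i - j\<bar>\<close> or \<open>n - \<bar>i + j - n - 1\<bar>\<close>. These two numbers are
  the distances of \<open>i - j\<close> and of \<open>i + j - 1\<close> to the nearest multiple of \<open>2 n\<close>. Summing over the
  cells with the weights of an alternating sign matrix \<open>A\<close>, the matrix is a transversal iff, with
  weights from \<open>A\<close>, every distance \<open>0 < k < n\<close> is taken twice, and the distances \<open>0\<close> and \<open>n\<close> once
  (lemma \<open>transversal_diamond_iff\<close>).

  Necessity: evaluate the weighted sum of the squares of all distances in two ways. Modulo \<open>4 n\<close> the
  square of the distance of \<open>v\<close> to \<open>2 n \<int>\<close> is \<open>v\<^sup>2\<close>, and \<open>(i - j)\<^sup>2 + (i + j - 1)\<^sup>2\<close> is a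
  function of \<open>i\<close> plus a function of \<open>j\<close>; as the rows and columns of \<open>A\<close> sum to \<open>1\<close>, its weighted
  sum does not depend on \<open>A\<close>. Comparison with the sum prescribed by the distance
  distribution gives that \<open>6\<close> divides \<open>n\<^sup>2 - 1\<close>.

  Sufficiency: there is even a transversal that is a permutation matrix. Put \<open>x = 2 i - 1\<close> and
  \<open>y = 2 j - 1\<close>, so that \<open>i - j = (x - y) / 2\<close> and \<open>i + j - 1 = (x + y) / 2\<close>. The numbers
  \<open>1, 3, \<dots>, 2 n - 1\<close> represent the odd residues modulo \<open>4 n\<close> up to sign, on which multiplication by
  \<open>3\<close> acts as a permutation when \<open>3\<close> does not divide \<open>n\<close>. Taking \<open>y = \<plusminus> 3 x\<close>, the
  half difference and half sum are, in some order and up to sign, \<open>x\<close> and \<open>2 x\<close> modulo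
  \<open>2 n\<close>. As \<open>x\<close> varies and \<open>n\<close> is odd, the former takes every odd distance and the latter every
  even distance, with exactly the multiplicities required.
\<close>

section \<open>Transversals of the diamond square through distances\<close>

text \<open>
  The number of times that \<open>k\<close> occurs among the distances of \<open>i - j\<close> and \<open>i + j - 1\<close> to the nearest
  multiple of \<open>2 n\<close>, for \<open>i\<close> and \<open>j\<close> between \<open>1\<close> and \<open>n\<close>.
\<close>

definition distance_count :: "nat \<Rightarrow> nat \<Rightarrow> nat \<Rightarrow> nat \<Rightarrow> int" where
  "distance_count n i j k =
     (if \<bar>int i - int j\<bar> = int k then 1 else 0) +
     (if int n - \<bar>int i + int j - int n - 1\<bar> = int k then 1 else 0)"

text \<open>
  Consecutive entries of a vertical line cancel, except where the line enters its support (just after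
  \<open>k = \<bar>i - j\<bar>\<close>) and where it leaves it; at both places the entry is \<open>1\<close>.
\<close>

lemma diamond_ashm_step:
  assumes "i \<in> {1..n}" "j \<in> {1..n}"
  shows "diamond_ashm n i j k + diamond_ashm n i j (Suc k) = distance_count n i j k"
proof -
  define a where "a = \<bar>int i - int j\<bar>"
  define b where "b = int n - \<bar>int i + int j - int n - 1\<bar>"
  have ab: "a < b" using assms by (auto simp: a_def b_def)
  have sign: "(-1::int) ^ (i + j + k + 1) = (if even (int i + int j + int k) then -1 else 1)"
    by (simp add: minus_one_power_iff)
  have pa: "even (int i + int j + int k)" if "a = int k"
  proof -
    have "int k = int i - int j \<or> int k = int j - int i"
      using that by (auto simp: a_def)
    then show ?thesis by presburger
  qed
  have pb: "odd (int i + int j + int k)" if "b = int k"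
  proof -
    have "int k = int i + int j - 1 \<or> int k = 2 * int n + 1 - int i - int j"
      using that by (auto simp: b_def)
    then show ?thesis by presburger
  qed
  have d0: "diamond_ashm n i j k = (if int k \<le> b \<and> a < int k then (-1) ^ (i + j + k + 1) else 0)"
    by (auto simp: diamond_ashm_def a_def b_def)
  have d1: "diamond_ashm n i j (Suc k) =
      (if int k < b \<and> a \<le> int k then - ((-1) ^ (i + j + k + 1)) else 0)"
    by (auto simp: diamond_ashm_def a_def b_def)
  have dc: "distance_count n i j k = (if a = int k then 1 else 0) + (if b = int k then 1 else 0)"
    by (simp add: distance_count_def a_def b_def)
  show ?thesis
    unfolding d0 d1 dc sign using ab pa pb by auto
qed

lemma diamond_ashm_outside:
  "diamond_ashm n i j 0 = 0" "diamond_ashm n i j (Suc n) = 0"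
  by (auto simp: diamond_ashm_def)

text \<open>
  Write \<open>T k\<close> for the inner product of \<open>A\<close> with plane \<open>k\<close>. The planes \<open>0\<close> and \<open>n + 1\<close> of the formula
  are zero, so the sums \<open>T k + T (k + 1)\<close> for \<open>k \<le> n\<close> determine all \<open>T k\<close> successively, and all
  \<open>T k\<close> with \<open>1 \<le> k \<le> n\<close> equal \<open>1\<close> iff these sums are \<open>1, 2, \<dots>, 2, 1\<close>.
\<close>

lemma transversal_diamond_iff:
  assumes "n \<ge> 1"
  shows "transversal n (diamond n) A \<longleftrightarrow>
    asm n A \<and> (\<forall>k\<le>n. (\<Sum>i=1..n. \<Sum>j=1..n. A i j * distance_count n i j k) =
      (if k = 0 \<or> k = n then 1 else 2))"
proof -
  define T where "T k = (\<Sum>i=1..n. \<Sum>j=1..n. A i j * diamond_ashm n i j k)" for k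
  define E where "E k = (\<Sum>i=1..n. \<Sum>j=1..n. A i j * distance_count n i j k)" for k
  have T: "matrix_inner n A (plane (diamond n) k) = T k" if "k \<in> {1..n}" for k
    using that by (simp add: matrix_inner_def T_def diamond_def plane_square_of)
  have E: "E k = T k + T (Suc k)" for k
    unfolding E_def T_def sum.distrib[symmetric]
    by (intro sum.cong refl) (simp add: diamond_ashm_step[symmetric] distrib_left)
  have T0: "T 0 = 0" and Tn: "T (Suc n) = 0"
    unfolding T_def by (intro sum.neutral ballI; simp add: diamond_ashm_outside)+
  have "(\<forall>k\<in>{1..n}. T k = 1) \<longleftrightarrow> (\<forall>k\<le>n. E k = (if k = 0 \<or> k = n then 1 else 2))"
  proof
    assume one: "\<forall>k\<in>{1..n}. T k = 1"
    show "\<forall>k\<le>n. E k = (if k = 0 \<or> k = n then 1 else 2)"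
    proof (intro allI impI)
      fix k assume "k \<le> n"
      then consider "k = 0" | "k = n" "k > 0" | "0 < k" "k < n" by linarith
      then show "E k = (if k = 0 \<or> k = n then 1 else 2)"
        by cases (use one assms in \<open>auto simp: E T0 Tn\<close>)
    qed
  next
    assume two: "\<forall>k\<le>n. E k = (if k = 0 \<or> k = n then 1 else 2)"
    have "T (Suc k) = 1" if "k < n" for k
      using that
    proof (induction k)
      case 0
      then show ?case using two E[of 0] T0 by simp
    next
      case (Suc k)
      then show ?case using two E[of "Suc k"] by simp
    qed
    then show "\<forall>k\<in>{1..n}. T k = 1"
      by (metis Suc_le_lessD Suc_pred' atLeastAtMost_iff less_eq_Suc_le One_nat_def)
  qed
  then show ?thesis by (simp add: transversal_def T E_def)
qed

section \<open>Necessity\<close>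

lemma two_sum_list_alternating:
  fixes xs :: "int list"
  assumes "xs \<noteq> []" "successively (\<lambda>x y. y = - x) xs"
  shows "2 * sum_list xs = hd xs + last xs"
  using assms
proof (induction xs)
  case (Cons x xs)
  then show ?case by (cases xs) auto
qed simp

lemma sum_alternating_line:
  assumes "alternating_line n f"
  shows "(\<Sum>i=1..n. f i) = 1"
proof -
  define xs where "xs = filter (\<lambda>x. x \<noteq> 0) (map f [1..<Suc n])"
  have "xs \<noteq> []" "hd xs = 1" "last xs = 1" "successively (\<lambda>x y. y = - x) xs"
    using assms unfolding alternating_line_def Let_def xs_def[symmetric] by blast+
  then have "sum_list xs = 1" using two_sum_list_alternating[of xs] by simp
  moreover have "sum_list (filter (\<lambda>x. x \<noteq> 0) ys) = sum_list ys" for ys :: "int list"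
    by (induction ys) auto
  ultimately have "sum_list (map f [1..<Suc n]) = 1" by (simp only: xs_def)
  then show ?thesis
    by (simp add: sum_list_distinct_conv_sum_set atLeastLessThanSuc_atLeastAtMost del: upt_Suc)
qed

lemma asm_weighted_sum:
  assumes "asm n A"
  shows "(\<Sum>i=1..n. \<Sum>j=1..n. A i j * (f i + g j)) = (\<Sum>i=1..n. f i) + (\<Sum>j=1..n. g j)"
proof -
  have row: "(\<Sum>j=1..n. A i j) = 1" if "i \<in> {1..n}" for i
    using assms that by (intro sum_alternating_line) (auto simp: asm_def)
  have col: "(\<Sum>i=1..n. A i j) = 1" if "j \<in> {1..n}" for j
    using assms that by (intro sum_alternating_line) (auto simp: asm_def)
  have "(\<Sum>i=1..n. \<Sum>j=1..n. A i j * f i) = (\<Sum>i=1..n. f i)"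
    by (intro sum.cong refl) (simp only: sum_distrib_right[symmetric] row mult_1)
  moreover have "(\<Sum>i=1..n. \<Sum>j=1..n. A i j * g j) = (\<Sum>j=1..n. g j)"
    by (subst sum.swap, intro sum.cong refl) (simp only: sum_distrib_right[symmetric] col mult_1)
  ultimately show ?thesis by (simp add: distrib_left sum.distrib)
qed

text \<open>
  Replacing \<open>v = i + j - 1\<close> by \<open>2 n - v\<close> changes its square by a multiple of \<open>4 n\<close>; the right-hand
  side is \<open>(i - j)\<^sup>2 + (i + j - 1)\<^sup>2\<close>, written without mixed terms.
\<close>

lemma sum_squared_distances_cong:
  assumes "i \<in> {1..n}" "j \<in> {1..n}"
  shows "[(\<Sum>k\<le>n. int k ^ 2 * distance_count n i j k) =
    (2 * int i ^ 2 - 2 * int i) + (2 * int j ^ 2 - 2 * int j + 1)] (mod (4 * int n))"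
proof -
  define a where "a = nat \<bar>int i - int j\<bar>"
  define b where "b = nat (int n - \<bar>int i + int j - int n - 1\<bar>)"
  have a: "a \<le> n" "int a = \<bar>int i - int j\<bar>" using assms by (auto simp: a_def)
  have b: "b \<le> n" "int b = int n - \<bar>int i + int j - int n - 1\<bar>" using assms by (auto simp: b_def)
  have "(\<Sum>k\<le>n. int k ^ 2 * distance_count n i j k) =
      (\<Sum>k\<le>n. (if a = k then int k ^ 2 else 0) + (if b = k then int k ^ 2 else 0))"
    by (intro sum.cong refl) (simp add: distance_count_def a(2)[symmetric] b(2)[symmetric])
  also have "\<dots> = int a ^ 2 + int b ^ 2"
    using a(1) b(1) by (simp add: sum.distrib)
  also have "[\<dots> = (2 * int i ^ 2 - 2 * int i) + (2 * int j ^ 2 - 2 * int j + 1)] (mod (4 * int n))"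
  proof (cases "i + j \<le> n + 1")
    case True
    then have b': "int b = int i + int j - 1" using b by linarith
    have "int a ^ 2 + int b ^ 2 =
      (2 * int i ^ 2 - 2 * int i) + (2 * int j ^ 2 - 2 * int j + 1)"
      unfolding a(2) b' power2_abs by (simp add: power2_eq_square algebra_simps)
    then show ?thesis by simp
  next
    case False
    then have b': "int b = 2 * int n + 1 - int i - int j" using b by linarith
    have "int a ^ 2 + int b ^ 2 =
      (2 * int i ^ 2 - 2 * int i) + (2 * int j ^ 2 - 2 * int j + 1) +
        4 * int n * (int n + 1 - int i - int j)"
      unfolding a(2) b' power2_abs by (simp add: power2_eq_square algebra_simps)
    then show ?thesis by (simp add: cong_def)
  qed
  finally show ?thesis .
qed

lemma three_sum_pronic: "3 * (\<Sum>i=1..n. 2 * int i ^ 2 - 2 * int i) = 2 * int n ^ 3 - 2 * int n"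
  by (induction n) (simp_all add: algebra_simps power2_eq_square power3_eq_cube)

lemma three_sum_double_squares: "3 * (\<Sum>k<n. 2 * int k ^ 2) = 2 * int n ^ 3 - 3 * int n ^ 2 + int n"
  by (induction n) (simp_all add: algebra_simps power2_eq_square power3_eq_cube)

lemma transversal_diamond_imp_dvd:
  assumes n: "n \<ge> 1" and A: "transversal n (diamond n) A"
  shows "6 dvd int n ^ 2 - 1"
proof -
  define E where "E k = (\<Sum>i=1..n. \<Sum>j=1..n. A i j * distance_count n i j k)" for k
  define p where "p = (\<Sum>i=1..n. 2 * int i ^ 2 - 2 * int i)"
  have asm: "asm n A" and E: "\<And>k. k \<le> n \<Longrightarrow> E k = (if k = 0 \<or> k = n then 1 else 2)"
    using A unfolding transversal_diamond_iff[OF n] E_def by blast+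
  have "(\<Sum>k\<le>n. int k ^ 2 * E k) = (\<Sum>k<n. int k ^ 2 * E k) + int n ^ 2 * E n"
    by (simp flip: lessThan_Suc_atMost)
  also have "(\<Sum>k<n. int k ^ 2 * E k) = (\<Sum>k<n. 2 * int k ^ 2)"
    by (intro sum.cong refl) (auto simp: E)
  finally have lhs: "3 * (\<Sum>k\<le>n. int k ^ 2 * E k) = 2 * int n ^ 3 + int n"
    using three_sum_double_squares[of n] by (simp add: E)
  have by_cells: "(\<Sum>k\<le>n. int k ^ 2 * E k) =
      (\<Sum>i=1..n. \<Sum>j=1..n. A i j * (\<Sum>k\<le>n. int k ^ 2 * distance_count n i j k))"
    unfolding E_def sum_distrib_left
    by (subst sum.swap, rule sum.cong[OF refl], subst sum.swap, rule sum.cong[OF refl])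
      (simp add: mult_ac)
  have "[(\<Sum>k\<le>n. int k ^ 2 * E k) = (\<Sum>i=1..n. \<Sum>j=1..n. A i j *
      ((2 * int i ^ 2 - 2 * int i) + (2 * int j ^ 2 - 2 * int j + 1)))] (mod (4 * int n))"
    unfolding by_cells by (intro cong_sum cong_mult cong_refl sum_squared_distances_cong)
  moreover have "(\<Sum>i=1..n. \<Sum>j=1..n. A i j *
      ((2 * int i ^ 2 - 2 * int i) + (2 * int j ^ 2 - 2 * int j + 1))) = p + (p + int n)"
    using asm_weighted_sum[OF asm, of "\<lambda>i. 2 * int i ^ 2 - 2 * int i"
      "\<lambda>j. 2 * int j ^ 2 - 2 * int j + 1"]
    by (simp only: sum.distrib p_def sum_constant card_atLeastAtMost diff_Suc_1 mult_1_right)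
  ultimately have "4 * int n dvd (\<Sum>k\<le>n. int k ^ 2 * E k) - (p + (p + int n))"
    by (simp only: cong_iff_dvd_diff)
  then have "3 * (4 * int n) dvd 3 * ((\<Sum>k\<le>n. int k ^ 2 * E k) - (p + (p + int n)))"
    by (rule mult_dvd_mono[OF dvd_refl])
  also have "3 * ((\<Sum>k\<le>n. int k ^ 2 * E k) - (p + (p + int n))) = (2 * int n) * (1 - int n ^ 2)"
    using lhs three_sum_pronic[of n, folded p_def]
    by (simp add: algebra_simps power2_eq_square power3_eq_cube)
  also have "3 * (4 * int n) = (2 * int n) * 6" by simp
  finally have "6 dvd 1 - int n ^ 2" using n by (subst (asm) dvd_times_left_cancel_iff) auto
  then show ?thesis by (metis dvd_minus_iff minus_diff_eq)
qed

lemma six_dvd_square_minus_one_iff: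
  fixes m :: int
  shows "6 dvd m ^ 2 - 1 \<longleftrightarrow> [m = 1] (mod 6) \<or> [m = -1] (mod 6)"
proof -
  have "m ^ 2 mod 6 = (m mod 6) ^ 2 mod 6" by (simp add: power_mod)
  moreover have "m mod 6 \<in> {0..<6}" by simp
  then have "m mod 6 \<in> {0, 1, 2, 3, 4, 5}" by auto
  ultimately show ?thesis
    by (auto simp: cong_def mod_eq_dvd_iff[symmetric])
qed

section \<open>Sufficiency\<close>

text \<open>
  With \<open>x = 2 i - 1\<close>, the number \<open>2 (tripling n i) - 1\<close> is the representative between \<open>1\<close> and
  \<open>2 n - 1\<close> of \<open>\<plusminus> 3 x\<close> modulo \<open>4 n\<close>; the three cases are \<open>3 x < 2 n\<close>, \<open>2 n < 3 x < 4 n\<close> and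
  \<open>4 n < 3 x\<close>.
\<close>

definition tripling :: "nat \<Rightarrow> nat \<Rightarrow> nat" where
  "tripling n i =
     (if 6 * i < 2 * n + 3 then 3 * i - 1
      else if 6 * i < 4 * n + 3 then 2 * n + 2 - 3 * i
      else 3 * i - 1 - 2 * n)"

lemma tripling_bij:
  assumes "\<not> 3 dvd n"
  shows "bij_betw (tripling n) {1..n} {1..n}"
proof -
  have range: "tripling n ` {1..n} \<subseteq> {1..n}"
    by (auto simp: tripling_def)
  have cases: "tripling n i + 1 = 3 * i \<or> tripling n i + 3 * i = 2 * n + 2
      \<or> tripling n i + 1 + 2 * n = 3 * i" if "i \<in> {1..n}" for i
    using that by (auto simp: tripling_def)
  have "inj_on (tripling n) {1..n}"
  proof (rule inj_onI)
    fix i i' assume i: "i \<in> {1..n}" "i' \<in> {1..n}" and eq: "tripling n i = tripling n i'"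
    (* Two different cases for i and i' would make 2 n or 4 n divisible by 3. *)
    have "2 * n + 3 \<noteq> 3 * t" "4 * n + 3 \<noteq> 3 * t" "2 * n + 3 * u \<noteq> 3 * t" for t u
      using assms by presburger+
    then have "2 * n + 3 \<noteq> 3 * (i + i')" "4 * n + 3 \<noteq> 3 * (i + i')"
      "2 * n + 3 * i \<noteq> 3 * i'" "2 * n + 3 * i' \<noteq> 3 * i" by blast+
    then show "i = i'"
      using cases[OF i(1)] cases[OF i(2)] unfolding eq by auto
  qed
  then show ?thesis using range by (simp add: bij_betw_def endo_inj_surj)
qed

text \<open>
  Up to sign and modulo \<open>2 n\<close>, the half difference and half sum of \<open>x\<close> and \<open>\<plusminus> 3 x\<close> are \<open>x\<close> and
  \<open>2 x\<close>. On the right, \<open>n - \<bar>x - n\<bar>\<close> and \<open>n - \<bar>\<bar>2 x - 2 n\<bar> - n\<bar>\<close> are their distances to \<open>2 n \<int>\<close>.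
\<close>

lemma distance_count_tripling:
  assumes "i \<in> {1..n}"
  defines "x \<equiv> 2 * int i - 1"
  shows "distance_count n i (tripling n i) k =
     (if int n - \<bar>x - int n\<bar> = int k then 1 else 0) +
     (if int n - \<bar>\<bar>2 * x - 2 * int n\<bar> - int n\<bar> = int k then 1 else 0)"
proof -
  consider (low) "6 * i < 2 * n + 3" | (mid) "2 * n + 3 \<le> 6 * i" "6 * i < 4 * n + 3"
    | (high) "4 * n + 3 \<le> 6 * i" by linarith
  then show ?thesis
  proof cases
    case low
    then have "int (tripling n i) = 3 * int i - 1" using assms by (auto simp: tripling_def)
    then have "\<bar>int i - int (tripling n i)\<bar> = int n - \<bar>x - int n\<bar>"
      "int n - \<bar>int i + int (tripling n i) - int n - 1\<bar> =
        int n - \<bar>\<bar>2 * x - 2 * int n\<bar> - int n\<bar>"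
      using low assms by auto
    then show ?thesis by (simp add: distance_count_def)
  next
    case mid
    then have "int (tripling n i) = 2 * int n + 2 - 3 * int i"
      using assms by (auto simp: tripling_def)
    then have "\<bar>int i - int (tripling n i)\<bar> = int n - \<bar>\<bar>2 * x - 2 * int n\<bar> - int n\<bar>"
      "int n - \<bar>int i + int (tripling n i) - int n - 1\<bar> = int n - \<bar>x - int n\<bar>"
      using mid assms by auto
    then show ?thesis by (simp add: distance_count_def)
  next
    case high
    then have "int (tripling n i) = 3 * int i - 1 - 2 * int n"
      using assms by (auto simp: tripling_def)
    then have "\<bar>int i - int (tripling n i)\<bar> = int n - \<bar>x - int n\<bar>"
      "int n - \<bar>int i + int (tripling n i) - int n - 1\<bar> =
        int n - \<bar>\<bar>2 * x - 2 * int n\<bar> - int n\<bar>"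
      using high assms by auto
    then show ?thesis by (simp add: distance_count_def)
  qed
qed

lemma card_odd_distance:
  assumes "odd n" "k \<le> n"
  shows "card {i \<in> {1..n}. int n - \<bar>(2 * int i - 1) - int n\<bar> = int k} =
    (if even k then 0 else if k = n then 1 else 2)"
    (is "card ?S = _")
proof (cases "even k")
  case True
  have "?S = {}"
  proof (intro equals0I)
    fix i assume "i \<in> ?S"
    then have "int k = 2 * int i - 1 \<or> int k = 2 * int n - (2 * int i - 1)" by auto
    then show False using True by presburger
  qed
  then show ?thesis using True by simp
next
  case False
  then obtain l where l: "k = 2 * l + 1" by (elim oddE)
  have S: "?S = {l + 1, n - l}" using l assms by auto
  have "l + 1 = n - l \<longleftrightarrow> k = n" using assms(2) l by linarith
  then show ?thesis unfolding S using False by (simp add: card_insert_if)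
qed

text \<open>
  The distance of \<open>2 x\<close> is \<open>2 l\<close> iff \<open>x\<close> is \<open>\<plusminus> l\<close> modulo \<open>n\<close>, that is \<open>x\<close> is one of \<open>l\<close>, \<open>n - l\<close>,
  \<open>n + l\<close> and \<open>2 n - l\<close>. As \<open>n\<close> is odd, two of these are odd: the outer ones or the inner ones,
  depending on the parity of \<open>l\<close>. For \<open>l = 0\<close> the inner ones coincide.
\<close>

lemma card_even_distance:
  assumes "odd n" "k \<le> n"
  shows "card {i \<in> {1..n}. int n - \<bar>\<bar>2 * (2 * int i - 1) - 2 * int n\<bar> - int n\<bar> = int k} =
    (if odd k then 0 else if k = 0 then 1 else 2)"
    (is "card ?S = _")
proof (cases "odd k")
  case True
  have "?S = {}"
  proof (intro equals0I)
    fix i assume "i \<in> ?S"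
    then have "int k = \<bar>2 * (2 * int i - 1) - 2 * int n\<bar> \<or>
        int k = 2 * int n - \<bar>2 * (2 * int i - 1) - 2 * int n\<bar>" by auto
    moreover have "even \<bar>2 * (2 * int i - 1) - 2 * int n\<bar>" by simp
    ultimately show False using True by presburger
  qed
  then show ?thesis using True by simp
next
  case False
  obtain l where l: "k = 2 * l" using False by (auto elim: evenE)
  obtain m where m: "n = 2 * m + 1" using assms(1) by (elim oddE)
  have S: "i \<in> ?S \<longleftrightarrow> i \<in> {1..n} \<and>
      (2 * i = l + 1 \<or> 2 * i + l = n + 1 \<or> 2 * i = n + l + 1 \<or> 2 * i + l = 2 * n + 1)" for i
    using assms(2) unfolding l by auto
  show ?thesis
  proof (cases "odd l")
    case True
    then obtain r where r: "l = 2 * r + 1" by (elim oddE)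
    have S': "?S = {r + 1, n - r}"
    proof (rule set_eqI)
      fix i
      have "2 * i + l \<noteq> n + 1" "2 * i \<noteq> n + l + 1" using r m by presburger+
      then show "i \<in> ?S \<longleftrightarrow> i \<in> {r + 1, n - r}"
        unfolding S using assms(2) l r by auto
    qed
    have "r + 1 \<noteq> n - r" "k \<noteq> 0" "even k" using assms(2) l r by auto
    then show ?thesis unfolding S' by (simp add: card_insert_if)
  next
    case False
    obtain r where r: "l = 2 * r" using False by (auto elim: evenE)
    have S': "?S = {m + 1 - r, m + 1 + r}"
    proof (rule set_eqI)
      fix i
      have "2 * i \<noteq> l + 1" "2 * i + l \<noteq> 2 * n + 1" using r by presburger+
      then show "i \<in> ?S \<longleftrightarrow> i \<in> {m + 1 - r, m + 1 + r}"
        unfolding S using assms(2) l r m by auto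
    qed
    have "m + 1 - r = m + 1 + r \<longleftrightarrow> k = 0" "even k" using assms(2) l r m by auto
    then show ?thesis unfolding S' by (simp add: card_insert_if)
  qed
qed

lemma alternating_line_single:
  assumes "p \<in> {1..n}" "\<And>i. i \<in> {1..n} \<Longrightarrow> f i = (if i = p then 1 else 0)"
  shows "alternating_line n f"
  using assms by (intro alternating_lineI[where a = p and b = p and c = p]) auto

lemma asm_permutation:
  assumes "bij_betw s {1..n} {1..n}"
  shows "asm n (\<lambda>i j. if j = s i then 1 else 0)"
  unfolding asm_def
proof (intro conjI ballI)
  fix i assume "i \<in> {1..n}"
  then show "alternating_line n (\<lambda>j. if j = s i then 1 else 0)"
    using assms by (intro alternating_line_single[where p = "s i"]) (auto simp: bij_betw_def)
next
  fix j assume "j \<in> {1..n}"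
  then have "j \<in> s ` {1..n}" by (simp only: bij_betw_imp_surj_on[OF assms])
  then obtain p where p: "p \<in> {1..n}" "s p = j" by (elim imageE) simp
  have "j = s i \<longleftrightarrow> i = p" if "i \<in> {1..n}" for i
    using bij_betw_imp_inj_on[OF assms] p that by (metis inj_onD)
  then show "alternating_line n (\<lambda>i. if j = s i then 1 else 0)"
    using p(1) by (intro alternating_line_single[where p = p]) simp_all
qed

lemma transversal_diamond_tripling:
  assumes n: "n \<ge> 1" and "odd n" "\<not> 3 dvd n"
  shows "transversal n (diamond n) (\<lambda>i j. if j = tripling n i then 1 else 0)"
  unfolding transversal_diamond_iff[OF n]
proof (intro conjI allI impI)
  have bij: "bij_betw (tripling n) {1..n} {1..n}" using assms by (intro tripling_bij)
  then show "asm n (\<lambda>i j. if j = tripling n i then 1 else 0)" by (rule asm_permutation)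
  fix k assume k: "k \<le> n"
  have "(\<Sum>i=1..n. \<Sum>j=1..n. (if j = tripling n i then 1 else 0) * distance_count n i j k) =
      (\<Sum>i=1..n. distance_count n i (tripling n i) k)"
  proof (intro sum.cong refl)
    fix i assume "i \<in> {1..n}"
    then have "tripling n i \<in> {1..n}" using bij by (auto simp: bij_betw_def)
    then show "(\<Sum>j=1..n. (if j = tripling n i then 1 else 0) * distance_count n i j k) =
        distance_count n i (tripling n i) k"
      by (simp add: if_distrib[where f = "\<lambda>c. c * _"] cong: if_cong)
  qed
  also have "\<dots> = int (card {i \<in> {1..n}. int n - \<bar>(2 * int i - 1) - int n\<bar> = int k}) +
      int (card {i \<in> {1..n}. int n - \<bar>\<bar>2 * (2 * int i - 1) - 2 * int n\<bar> - int n\<bar> = int k})"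
    by (simp only: distance_count_tripling sum.distrib sum.If_cases finite_atLeastAtMost
        sum_constant sum.neutral_const Int_def mem_Collect_eq cong: sum.cong)
  also have "\<dots> = (if k = 0 \<or> k = n then 1 else 2)"
    unfolding card_odd_distance[OF \<open>odd n\<close> k] card_even_distance[OF \<open>odd n\<close> k]
    using \<open>odd n\<close> by auto
  finally show "(\<Sum>i=1..n. \<Sum>j=1..n. (if j = tripling n i then 1 else 0) * distance_count n i j k) =
      (if k = 0 \<or> k = n then 1 else 2)" .
qed

theorem theorem5p10:
  fixes n :: nat
  assumes "n \<ge> 1"
  shows "(\<exists>A. transversal n (diamond n) A) \<longleftrightarrow> [int n = 1] (mod 6) \<or> [int n = -1] (mod 6)"
proof
  assume "\<exists>A. transversal n (diamond n) A"
  then show "[int n = 1] (mod 6) \<or> [int n = -1] (mod 6)"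
    using transversal_diamond_imp_dvd[OF assms] six_dvd_square_minus_one_iff by blast
next
  assume "[int n = 1] (mod 6) \<or> [int n = -1] (mod 6)"
  then have "int (n mod 6) = 1 \<or> int (n mod 6) = 5" by (simp add: cong_def zmod_int)
  then have "n mod 6 = 1 \<or> n mod 6 = 5" by linarith
  then have "odd n" "\<not> 3 dvd n" by presburger+
  then show "\<exists>A. transversal n (diamond n) A"
    using transversal_diamond_tripling[OF assms] by blast
qed

end
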